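(* Let $A\in\mathbb{R}^{m\times n}$ be nonzero and let $b\in\mathbb{R}^m$ be such that the linear system $Ax=b$ is consistent. Let $\rho>0$ be a constant and let $\mathcal{D}$ be a distribution of random matrix quadruples $(S_1,S_2,T_1,T_2)$ with $T_1=T_2=\sqrt{\rho}\, I$ and satisfying $\mathbb{E}[T_1T_2^\top A^\top S_1S_2^\top]=\frac{A^\top}{\|A\|_F^2}$. Let $x^1=x^0\in\mathbb{R}^n$ be arbitrary (deterministic) initial vectors and let $\{x^k\}$ be generated by the mPFR iteration $$x^{k+1}=x^{k}-\alpha T_1T_2^\top A^\top S_1S_2^\top(Ax^{k}-b)+\omega(x^k-x^{k-1}),\qquad k\ge 1,$$ where at each iteration a fresh quadruple $(S_1,S_2,T_1,T_2)$ is drawn independently from $\mathcal{D}$. Denote $x^0_*=A^{\dagger}b+(I-A^\dagger A)x^0$ and $$\beta_3=\big\|\mathbb{E}[ S_2S_1^\top AA^\top S_1S_2^\top ]\big\|_2.$$ Assume $0<\alpha<\frac{2}{\rho^2\beta_3\|A\|^2_F}$, $\omega\geq0$, and that the expressions $$\gamma_1=1+3\omega+2\omega^2-\big(2\alpha-\alpha^2\rho^2\beta_3\|A\|^2_F+\alpha\omega\big)\frac{\sigma_{\min}^2(A)}{\|A\|^2_F}\quad\text{and}\quad\gamma_2=2\omega^2+\omega+\omega\alpha\frac{\sigma^2_{\max}(A)}{\|A\|^2_F}$$ satisfy $\gamma_1+\gamma_2<1$. Then $$\mathbb{E}[\|x^{k+1}-x_*^0\|^2_2]\leq q^k(1+\tau)\|x^0-x_*^0\|^2_2\qquad\text{for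 all } k\geq 0,$$ where $q=\frac{\gamma_1+\sqrt{\gamma_1^2+4\gamma_2}}{2}$ if $\omega>0$, $q=\gamma_1$ if $\omega=0$, and $\tau=q-\gamma_1\geq 0$. Moreover, $\gamma_1+\gamma_2\leq q<1$.
   Context: $A^\dagger$ is the Moore-Penrose pseudoinverse; $\|\cdot\|_F$ is the Frobenius norm; $\|\cdot\|_2$ is the Euclidean norm of a vector or the spectral norm of a matrix; $\sigma_{\max}(A)$ is the largest singular value and $\sigma_{\min}(A)$ the smallest nonzero singular value of $A$. $A$ may have any rank. Here $I$ is the $n\times n$ identity, and $S_1,S_2\in\mathbb{R}^{m\times p}$, where $p$ may itself be random; $S_1,S_2$ need not be independent of each other, but the samples used at different iterations are independent and identically distributed. All expectations appearing are assumed to exist and be finite. *)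

theory Defs
  imports "HOL-Probability.Probability"
begin

definition frob_norm :: "real^'n^'m \<Rightarrow> real" where
  "frob_norm A = sqrt (\<Sum>i\<in>UNIV. \<Sum>j\<in>UNIV. (A $ i $ j)\<^sup>2)"

text \<open>The Moore-Penrose pseudoinverse is the unique solution of the four Penrose equations.\<close>

definition pinv :: "real^'n^'m \<Rightarrow> real^'m^'n" where
  "pinv A = (THE X. A ** X ** A = A \<and> X ** A ** X = X \<and>
     transpose (A ** X) = A ** X \<and> transpose (X ** A) = X ** A)"

text \<open>
  Asking for a left and a right singular vector makes \<open>0\<close> a singular value exactly if the rank of
  \<open>A\<close> is less than \<open>min m n\<close>, in agreement with the singular value decomposition.
\<close>

definition singular_values :: "real^'n^'m \<Rightarrow> real set" where
  "singular_values A = {\<sigma>. \<sigma> \<ge> 0 \<and>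
     (\<exists>u v. norm u = 1 \<and> norm v = 1 \<and> A *v v = \<sigma> *\<^sub>R u \<and> transpose A *v u = \<sigma> *\<^sub>R v)}"

definition sigma_max :: "real^'n^'m \<Rightarrow> real" where
  "sigma_max A = Max (singular_values A)"

definition sigma_min :: "real^'n^'m \<Rightarrow> real" where
  "sigma_min A = Min (singular_values A - {0})"

text \<open>
  A sample \<open>(p, S\<^sub>1, S\<^sub>2, T\<^sub>1, T\<^sub>2)\<close> is a matrix quadruple. As the number \<open>p\<close> of columns of \<open>S\<^sub>1\<close>
  and \<open>S\<^sub>2\<close> may be random, it cannot be a type: an \<open>m \<times> p\<close> matrix is stored as the sequence of its
  columns, of which only those with index below \<open>p\<close> are ever read. The Borel sets of this type
  are the product of the Borel sets of the factors (\<open>nat\<close> being discrete).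
\<close>

type_synonym ('m, 'n) sample =
  "nat \<times> (nat \<Rightarrow> real^'m) \<times> (nat \<Rightarrow> real^'m) \<times> (real^'n^'n) \<times> (real^'n^'n)"

text \<open>The product \<open>S R\<^sup>T\<close> of two \<open>m \<times> p\<close> matrices given by their columns.\<close>

definition mult_transpose :: "nat \<Rightarrow> (nat \<Rightarrow> real^'m) \<Rightarrow> (nat \<Rightarrow> real^'m) \<Rightarrow> real^'m^'m" where
  "mult_transpose p S R = (\<chi> i j. \<Sum>l<p. S l $ i * R l $ j)"

fun step_matrix :: "real^'n^'m \<Rightarrow> ('m, 'n) sample \<Rightarrow> real^'m^'n" where
  "step_matrix A (p, S1, S2, T1, T2) =
     T1 ** transpose T2 ** transpose A ** mult_transpose p S1 S2"

fun second_moment_matrix :: "real^'n^'m \<Rightarrow> ('m, 'n) sample \<Rightarrow> real^'m^'m" where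
  "second_moment_matrix A (p, S1, S2, T1, T2) =
     mult_transpose p S2 S1 ** A ** transpose A ** mult_transpose p S1 S2"

end

theory Submission imports Defs begin

text \<open>
  For the error \<open>e\<^sub>k = x\<^sub>k - x\<^sub>*\<close> the iteration reads
  \<open>e\<^sub>k\<^sub>+\<^sub>1 = d\<^sub>k - \<alpha> G\<^sub>k A e\<^sub>k\<close> with \<open>d\<^sub>k = e\<^sub>k + \<omega> (e\<^sub>k - e\<^sub>k\<^sub>-\<^sub>1)\<close> and
  \<open>G\<^sub>k = \<rho> A\<^sup>T S\<^sub>1 S\<^sub>2\<^sup>T\<close> independent of \<open>(e\<^sub>k, e\<^sub>k\<^sub>-\<^sub>1)\<close>. Expanding the square and replacing
  \<open>G\<^sub>k\<close> and \<open>G\<^sub>k\<^sup>T G\<^sub>k\<close> by their means leaves the deterministic expression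
  \<open>|d|\<^sup>2 - 2 \<alpha> \<langle>A d, A e\<rangle> / |A|\<^sub>F\<^sup>2 + \<alpha>\<^sup>2 \<rho>\<^sup>2 \<langle>A e, E[S\<^sub>2 S\<^sub>1\<^sup>T A A\<^sup>T S\<^sub>1 S\<^sub>2\<^sup>T] A e\<rangle>\<close>. All errors stay in
  the row space of \<open>A\<close>, where \<open>|A e| \<ge> \<sigma>\<^sub>m\<^sub>i\<^sub>n |e|\<close>, so this expression is at most
  \<open>\<gamma>\<^sub>1 |e\<^sub>k|\<^sup>2 + \<gamma>\<^sub>2 |e\<^sub>k\<^sub>-\<^sub>1|\<^sup>2\<close>. Since \<open>q \<tau> = \<gamma>\<^sub>2\<close> and \<open>\<gamma>\<^sub>1 + \<tau> = q\<close>, the quantity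
  \<open>E|e\<^sub>k\<^sub>+\<^sub>1|\<^sup>2 + \<tau> E|e\<^sub>k|\<^sup>2\<close> shrinks by the factor \<open>q\<close> in each step.
\<close>

section \<open>The Moore-Penrose inverse\<close>

lemma inner_matrix_vector_mult:
  fixes A :: "real^'n^'m"
  shows "x \<bullet> (A *v y) = (transpose A *v x) \<bullet> y"
  by (simp add: dot_lmul_matrix)

lemma norm_matrix_vector_mult_squared:
  fixes A :: "real^'n^'m"
  shows "(norm (A *v y))\<^sup>2 = y \<bullet> ((transpose A ** A) *v y)"
  by (metis power2_norm_eq_inner inner_matrix_vector_mult matrix_vector_mul_assoc inner_commute
      transpose_transpose)

text \<open>Since |A z|^2 = <z, A^T A z>, the matrices A^T A and A have the same kernel, so the
  leading A^T can be cancelled.\<close>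

lemma normal_equation_cancel:
  fixes A :: "real^'n^'m" and X Y :: "real^'k^'n"
  assumes "transpose A ** A ** X = transpose A ** A ** Y"
  shows "A ** X = A ** Y"
proof -
  have "A *v (X *v z) = A *v (Y *v z)" for z
  proof -
    have "(norm (A *v (X *v z - Y *v z)))\<^sup>2 = 0"
      unfolding norm_matrix_vector_mult_squared
      using arg_cong [OF assms, of "\<lambda>B. B *v z"]
      by (simp add: algebra_simps matrix_vector_mul_assoc)
    then show ?thesis by (simp add: algebra_simps)
  qed
  then show ?thesis by (simp add: matrix_eq matrix_vector_mul_assoc [symmetric])
qed

lemma generalized_inverse_exists:
  fixes B :: "real^'n^'m"
  obtains G where "B ** G ** B = B"
proof -
  obtain g where g: "linear g" "\<forall>v \<in> range ((*v) B). B *v g v = v"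
    using linear_exists_right_inverse_on [OF matrix_vector_mul_linear, of UNIV B] by auto
  have "B ** matrix g ** B = B"
    using g by (simp add: matrix_eq matrix_vector_mul_assoc [symmetric] matrix_works)
  then show ?thesis by (rule that)
qed

text \<open>Take L = G A^T with G a generalized inverse of the Gram matrix A^T A. As G need not be
  symmetric, the symmetry of A L rests on the transpose of G being a generalized inverse of the Gram
  matrix as well.\<close>

lemma least_squares_inverse_exists:
  fixes A :: "real^'n^'m"
  obtains L where "A ** L ** A = A" "transpose (A ** L) = A ** L"
proof -
  \<comment> \<open>Stated for any \<open>H\<close> because it serves both \<open>G\<close> and its
    transpose.\<close>
  have *: "A ** (H ** transpose A) ** A = A"
    if "transpose A ** A ** H ** (transpose A ** A) = transpose A ** A" for H
    using normal_equation_cancel [of A "H ** (transpose A ** A)" "mat 1"] that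
    by (simp add: matrix_mul_assoc)
  obtain G where G: "transpose A ** A ** G ** (transpose A ** A) = transpose A ** A"
    by (rule generalized_inverse_exists)
  define L where "L = G ** transpose A"
  have 1: "A ** L ** A = A"
    unfolding L_def using G by (rule *)
  have "A ** (transpose G ** transpose A) ** A = A"
    using arg_cong [OF G, of transpose]
    by (intro *) (simp add: matrix_transpose_mul matrix_mul_assoc)
  then have "transpose (A ** (transpose G ** transpose A) ** A) = transpose A"
    by simp
  then have "transpose A ** A ** L = transpose A"
    by (simp add: L_def matrix_transpose_mul matrix_mul_assoc)
  \<comment> \<open>This writes the transpose of \<open>A ** L\<close> as P^T P with P = A L, which
    is visibly symmetric.\<close>
  then have "transpose L ** (transpose A ** A ** L) = transpose L ** transpose A"
    by simp
  then have "transpose (A ** L) ** (A ** L) = transpose (A ** L)"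
    by (simp add: matrix_transpose_mul matrix_mul_assoc)
  then have "transpose (A ** L) = A ** L"
    by (metis matrix_transpose_mul transpose_transpose)
  with 1 show ?thesis by (rule that)
qed

text \<open>A X and A Y are both the orthogonal projection onto the range of A, X A and Y A both the
  one onto its row space. Then X = X A X = Y A X = Y A Y = Y.\<close>

lemma penrose_unique:
  fixes A :: "real^'n^'m"
  assumes X: "A ** X ** A = A" "X ** A ** X = X"
      "transpose (A ** X) = A ** X" "transpose (X ** A) = X ** A"
    and Y: "A ** Y ** A = A" "Y ** A ** Y = Y"
      "transpose (A ** Y) = A ** Y" "transpose (Y ** A) = Y ** A"
  shows "X = Y"
proof -
  have "A ** X = transpose ((A ** Y) ** (A ** X))"
    using X Y by (simp add: matrix_mul_assoc)
  also have "\<dots> = (A ** X) ** (A ** Y)"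
    using X Y by (metis matrix_transpose_mul)
  also have "\<dots> = A ** Y"
    using X by (simp add: matrix_mul_assoc)
  finally have AX: "A ** X = A ** Y" .
  have "X ** A = transpose ((X ** A) ** (Y ** A))"
    using X Y by (metis matrix_mul_assoc)
  also have "\<dots> = (Y ** A) ** (X ** A)"
    using X Y by (metis matrix_transpose_mul)
  also have "\<dots> = Y ** A"
    using X by (metis matrix_mul_assoc)
  finally have XA: "X ** A = Y ** A" .
  show ?thesis
    using X Y AX XA by (metis matrix_mul_assoc)
qed

text \<open>Existence comes from two one-sided solutions: \<open>L\<close> makes A L symmetric, and
  \<open>R\<close>, transposed from such an inverse of A^T, makes R A symmetric. The product R A L
  inherits both properties.\<close>

lemma pinv_penrose:
  fixes A :: "real^'n^'m"
  shows "A ** pinv A ** A = A" "pinv A ** A ** pinv A = pinv A"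
    "transpose (A ** pinv A) = A ** pinv A" "transpose (pinv A ** A) = pinv A ** A"
proof -
  obtain L where L: "A ** L ** A = A" "transpose (A ** L) = A ** L"
    by (rule least_squares_inverse_exists)
  obtain R' where R': "transpose A ** R' ** transpose A = transpose A"
      "transpose (transpose A ** R') = transpose A ** R'"
    by (rule least_squares_inverse_exists)
  define R where "R = transpose R'"
  have R: "A ** R ** A = A" "transpose (R ** A) = R ** A"
    using arg_cong [OF R'(1), of transpose] R'(2)
    by (simp_all add: R_def matrix_transpose_mul matrix_mul_assoc)
  define X where "X = R ** A ** L"
  have AX: "A ** X = A ** L"
    using R by (metis X_def matrix_mul_assoc)
  have XA: "X ** A = R ** A"
    using L by (metis X_def matrix_mul_assoc)
  have X: "A ** X ** A = A" "X ** A ** X = X"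
      "transpose (A ** X) = A ** X" "transpose (X ** A) = X ** A"
    using AX XA L R by (simp_all, metis X_def matrix_mul_assoc)
  have "\<exists>!X. A ** X ** A = A \<and> X ** A ** X = X \<and>
     transpose (A ** X) = A ** X \<and> transpose (X ** A) = X ** A"
    using X penrose_unique [OF _ _ _ _ X] by blast
  from theI' [OF this]
  show "A ** pinv A ** A = A" "pinv A ** A ** pinv A = pinv A"
    "transpose (A ** pinv A) = A ** pinv A" "transpose (pinv A ** A) = pinv A ** A"
    unfolding pinv_def by blast+
qed

text \<open>Symmetry of \<open>pinv A ** A\<close> lets A^T be factored out of \<open>pinv A\<close>
  on the left. This places the initial error in the row space.\<close>

lemma pinv_in_row_space:
  fixes A :: "real^'n^'m"
  shows "pinv A *v y \<in> range ((*v) (transpose A))"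
proof -
  have "pinv A = transpose (pinv A ** A) ** pinv A"
    by (simp add: pinv_penrose)
  also have "\<dots> = transpose A ** (transpose (pinv A) ** pinv A)"
    by (simp add: matrix_transpose_mul matrix_mul_assoc)
  finally have "pinv A *v y = transpose A *v ((transpose (pinv A) ** pinv A) *v y)"
    by (metis matrix_vector_mul_assoc)
  then show ?thesis by blast
qed

section \<open>Extreme singular values\<close>

text \<open>First-order optimality without derivatives: \<open>v\<close> minimizes the form on
  \<open>W\<close>, so a step from \<open>v\<close> along \<open>- f v\<close> cannot make it
  negative. For short steps the term linear in \<open>s\<close> would dominate unless
  \<open>f v = 0\<close>.\<close>

lemma nonneg_form_kernel:
  fixes f :: "'a::real_inner \<Rightarrow> 'a"
  assumes W: "subspace W" and f: "linear f" and W_inv: "\<And>w. w \<in> W \<Longrightarrow> f w \<in> W"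
    and sym: "\<And>x y. f x \<bullet> y = x \<bullet> f y" and nonneg: "\<And>w. w \<in> W \<Longrightarrow> 0 \<le> w \<bullet> f w"
    and v: "v \<in> W" "v \<bullet> f v = 0"
  shows "f v = 0"
proof -
  define c where "c = f v \<bullet> f (f v)"
  have *: "2 * (norm (f v))\<^sup>2 \<le> s * c" if "s > 0" for s
  proof -
    have "v - s *\<^sub>R f v \<in> W"
      using W W_inv v by (simp add: subspace_diff subspace_scale)
    then have "0 \<le> (v - s *\<^sub>R f v) \<bullet> f (v - s *\<^sub>R f v)"
      by (rule nonneg)
    also have "\<dots> = s * (s * c - 2 * (norm (f v))\<^sup>2)"
      using v sym [of v "f v"]
      by (simp add: linear_diff [OF f] linear_scale [OF f] c_def inner_diff power2_norm_eq_inner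
          algebra_simps)
    finally show ?thesis
      using that by (simp add: zero_le_mult_iff)
  qed
  have "c \<ge> 0"
    using nonneg W_inv v unfolding c_def by blast
  have "(norm (f v))\<^sup>2 \<le> 0"
  proof (rule ccontr)
    assume "\<not> (norm (f v))\<^sup>2 \<le> 0"
    then have pos: "(norm (f v))\<^sup>2 > 0" by simp
    \<comment> \<open>The step length is short enough to contradict positivity; \<open>c + 1\<close>
      instead of \<open>c\<close> covers \<open>c = 0\<close>.\<close>
    have "2 * (norm (f v))\<^sup>2 \<le> ((norm (f v))\<^sup>2 / (c + 1)) * c"
      using pos \<open>c \<ge> 0\<close> by (intro *) simp
    also have "\<dots> \<le> (norm (f v))\<^sup>2"
      using pos \<open>c \<ge> 0\<close> by (simp add: field_simps)
    finally show False using pos by simp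
  qed
  then show ?thesis by simp
qed

text \<open>By compactness the form attains its minimum \<mu> on the unit sphere of \<open>W\<close>
  at some \<open>v\<close>. The form of f - \<mu> is then nonnegative on \<open>W\<close> and zero
  at \<open>v\<close>, so \<open>nonneg_form_kernel\<close> makes \<open>v\<close> an
  eigenvector.\<close>

lemma min_rayleigh_eigenvector:
  fixes f :: "'a::euclidean_space \<Rightarrow> 'a"
  assumes W: "subspace W" "W \<noteq> {0}" and f: "linear f" and W_inv: "\<And>w. w \<in> W \<Longrightarrow> f w \<in> W"
    and sym: "\<And>x y. f x \<bullet> y = x \<bullet> f y"
  obtains v \<mu> where "v \<in> W" "norm v = 1" "f v = \<mu> *\<^sub>R v"
    "\<And>w. w \<in> W \<Longrightarrow> \<mu> * (norm w)\<^sup>2 \<le> w \<bullet> f w"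
proof -
  obtain w0 where w0: "w0 \<in> W" "w0 \<noteq> 0"
    using W subspace_0 by fastforce
  have "compact (W \<inter> sphere 0 1)"
    using closed_subspace [OF W(1)] by (simp add: closed_Int_compact)
  moreover have "w0 /\<^sub>R norm w0 \<in> W \<inter> sphere 0 1"
    using W w0 by (simp add: subspace_scale)
  moreover have "continuous_on (W \<inter> sphere 0 1) (\<lambda>w. w \<bullet> f w)"
    using f by (intro continuous_on_inner continuous_on_id linear_continuous_on linear_conv_bounded_linear [THEN iffD1])
  ultimately have "\<exists>v \<in> W \<inter> sphere 0 1. \<forall>w \<in> W \<inter> sphere 0 1. v \<bullet> f v \<le> w \<bullet> f w"
    by (intro continuous_attains_inf) auto
  then obtain v where v: "v \<in> W" "norm v = 1"
    and min: "\<And>w. w \<in> W \<Longrightarrow> norm w = 1 \<Longrightarrow> v \<bullet> f v \<le> w \<bullet> f w"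
    by auto
  define \<mu> where "\<mu> = v \<bullet> f v"
  have le: "\<mu> * (norm w)\<^sup>2 \<le> w \<bullet> f w" if "w \<in> W" for w
  proof (cases "w = 0")
    case True
    then show ?thesis by (simp add: linear_0 [OF f])
  next
    case False
    then have "\<mu> \<le> (w /\<^sub>R norm w) \<bullet> f (w /\<^sub>R norm w)"
      unfolding \<mu>_def using that W by (intro min) (auto simp: subspace_scale)
    also have "\<dots> = (w \<bullet> f w) / (norm w)\<^sup>2"
      by (simp add: linear_scale [OF f] power2_eq_square divide_simps)
    finally show ?thesis using False by (simp add: field_simps)
  qed
  have "f v - \<mu> *\<^sub>R v = 0"
  proof (rule nonneg_form_kernel [of W "\<lambda>w. f w - \<mu> *\<^sub>R w"])
    show "linear (\<lambda>w. f w - \<mu> *\<^sub>R w)"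
      by (intro linear_compose_sub f linear_scaleR)
  qed (use W W_inv v le sym in \<open>auto simp: subspace_diff subspace_scale inner_diff
        power2_norm_eq_inner [symmetric] \<mu>_def\<close>)
  then have "f v = \<mu> *\<^sub>R v" by simp
  with v le show ?thesis by (intro that) auto
qed

lemma gram_eigenvector_of_singular_value:
  fixes A :: "real^'n^'m"
  assumes "\<sigma> \<in> singular_values A"
  obtains v where "norm v = 1" "transpose A *v (A *v v) = \<sigma>\<^sup>2 *\<^sub>R v"
proof -
  obtain u v where "norm v = 1" "A *v v = \<sigma> *\<^sub>R u" "transpose A *v u = \<sigma> *\<^sub>R v"
    using assms by (auto simp: singular_values_def simp del: transpose_matrix_vector)
  then have "transpose A *v (A *v v) = \<sigma>\<^sup>2 *\<^sub>R v"
    by (simp add: matrix_vector_mult_scaleR power2_eq_square del: transpose_matrix_vector)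
  with \<open>norm v = 1\<close> show ?thesis by (rule that)
qed

text \<open>The left singular vector is A v / sqrt \<mu>, of unit length because |A v|^2 = <v, A^T A
  v> = \<mu>.\<close>

lemma singular_value_of_gram_eigenvector:
  fixes A :: "real^'n^'m"
  assumes "norm v = 1" "transpose A *v (A *v v) = \<mu> *\<^sub>R v" "A *v v \<noteq> 0"
  shows "sqrt \<mu> \<in> singular_values A - {0}" "\<mu> > 0"
proof -
  have "\<mu> = v \<bullet> (\<mu> *\<^sub>R v)"
    using assms(1) by (simp add: norm_eq_1)
  also have "\<dots> = (norm (A *v v))\<^sup>2"
    unfolding assms(2) [symmetric] norm_matrix_vector_mult_squared matrix_vector_mul_assoc ..
  finally have \<mu>: "sqrt \<mu> = norm (A *v v)" by simp
  then show "\<mu> > 0" using assms(3) by (metis zero_less_norm_iff real_sqrt_gt_0_iff)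
  have "\<exists>u. norm u = 1 \<and> A *v v = sqrt \<mu> *\<^sub>R u \<and> transpose A *v u = sqrt \<mu> *\<^sub>R v"
  proof (intro exI conjI)
    show "norm ((A *v v) /\<^sub>R sqrt \<mu>) = 1"
      using \<mu> assms(3) by simp
    show "A *v v = sqrt \<mu> *\<^sub>R ((A *v v) /\<^sub>R sqrt \<mu>)"
      using \<mu> assms(3) by simp
    show "transpose A *v ((A *v v) /\<^sub>R sqrt \<mu>) = sqrt \<mu> *\<^sub>R v"
      using \<open>\<mu> > 0\<close> assms(2)
      by (simp add: matrix_vector_mult_scaleR real_div_sqrt divide_inverse_commute [symmetric]
           del: transpose_matrix_vector)
  qed
  then show "sqrt \<mu> \<in> singular_values A - {0}"
    using assms(1) \<open>\<mu> > 0\<close> unfolding singular_values_def by auto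
qed

text \<open>Gram eigenvectors for different singular values are orthogonal, hence linearly independent.\<close>

lemma finite_singular_values:
  fixes A :: "real^'n^'m"
  shows "finite (singular_values A)"
proof -
  have "\<exists>v. norm v = 1 \<and> transpose A *v (A *v v) = \<sigma>\<^sup>2 *\<^sub>R v" if "\<sigma> \<in> singular_values A" for \<sigma>
    using gram_eigenvector_of_singular_value [OF that] by metis
  then obtain V where V: "norm (V \<sigma>) = 1" "transpose A *v (A *v V \<sigma>) = \<sigma>\<^sup>2 *\<^sub>R V \<sigma>"
    if "\<sigma> \<in> singular_values A" for \<sigma>
    by metis
  have orth: "V s \<bullet> V t = 0" if "s \<in> singular_values A" "t \<in> singular_values A" "s \<noteq> t" for s t
  proof -
    have "s\<^sup>2 * (V s \<bullet> V t) = (transpose A *v (A *v V s)) \<bullet> V t"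
      using that V by (simp del: transpose_matrix_vector)
    also have "\<dots> = V s \<bullet> (transpose A *v (A *v V t))"
      by (metis inner_commute inner_matrix_vector_mult transpose_transpose)
    also have "\<dots> = t\<^sup>2 * (V s \<bullet> V t)"
      using that V by (simp del: transpose_matrix_vector)
    finally have "(s\<^sup>2 - t\<^sup>2) * (V s \<bullet> V t) = 0"
      by (simp add: algebra_simps)
    moreover have "s\<^sup>2 \<noteq> t\<^sup>2"
      using that by (auto simp: singular_values_def)
    ultimately show ?thesis by simp
  qed
  have inj: "inj_on V (singular_values A)"
    using orth V(1) by (metis inj_onI inner_eq_zero_iff norm_zero zero_neq_one)
  have "pairwise orthogonal (V ` singular_values A)"
    using orth by (auto simp: pairwise_def orthogonal_def)
  moreover have "0 \<notin> V ` singular_values A"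
    using V(1) by force
  ultimately have "finite (V ` singular_values A)"
    by (simp add: independent_bound pairwise_orthogonal_independent)
  then show ?thesis
    using inj finite_imageD by blast
qed

text \<open>The row space is invariant under A^T A, so the least Rayleigh quotient there is an
  eigenvalue \<mu>. It is positive, hence its root is a nonzero singular value and at least
  \<open>sigma_min A\<close>.\<close>

lemma sigma_min_bound:
  fixes A :: "real^'n^'m"
  assumes "A \<noteq> 0" "e \<in> range ((*v) (transpose A))"
  shows "(sigma_min A)\<^sup>2 * (norm e)\<^sup>2 \<le> (norm (A *v e))\<^sup>2"
proof -
  let ?W = "range ((*v) (transpose A))"
  have W: "subspace ?W"
    by (rule linear_subspace_image) (simp_all del: transpose_matrix_vector)
  have W_nz: "?W \<noteq> {0}"
  proof
    assume "?W = {0}"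
    then have "transpose A = 0" by (auto simp: matrix_eq simp del: transpose_matrix_vector)
    then have "A = 0" by (simp add: vec_eq_iff transpose_def)
    with assms(1) show False by simp
  qed
  obtain v \<mu> where v: "v \<in> ?W" "norm v = 1" "transpose A *v (A *v v) = \<mu> *\<^sub>R v"
    and le: "\<And>w. w \<in> ?W \<Longrightarrow> \<mu> * (norm w)\<^sup>2 \<le> w \<bullet> (transpose A *v (A *v w))"
  proof (rule min_rayleigh_eigenvector [OF W W_nz, of "\<lambda>w. transpose A *v (A *v w)"])
    show "linear (\<lambda>w. transpose A *v (A *v w))"
      unfolding matrix_vector_mul_assoc by (rule matrix_vector_mul_linear)
    show "(transpose A *v (A *v x)) \<bullet> y = x \<bullet> (transpose A *v (A *v y))" for x y
      by (metis inner_commute inner_matrix_vector_mult transpose_transpose)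
  qed (auto simp del: transpose_matrix_vector)
  \<comment> \<open>The row space is orthogonal to the kernel of A, so the unit vector
    \<open>v\<close> cannot lie in both.\<close>
  have "A *v v \<noteq> 0"
  proof
    assume "A *v v = 0"
    obtain y where "v = transpose A *v y" using v(1) by blast
    then have "v \<bullet> v = y \<bullet> (A *v v)" by (simp only: inner_matrix_vector_mult)
    with \<open>A *v v = 0\<close> v(2) show False by simp
  qed
  with v have \<mu>: "sqrt \<mu> \<in> singular_values A - {0}" "\<mu> > 0"
    using singular_value_of_gram_eigenvector by blast+
  \<comment> \<open>A minimum of a finite nonempty set belongs to it; this gives the sign required
    for squaring the comparison with \<open>sqrt \<mu>\<close>.\<close>
  have "sigma_min A \<in> singular_values A - {0}"
    unfolding sigma_min_def using \<mu>(1) finite_singular_values by (intro Min_in) auto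
  then have "sigma_min A \<ge> 0" by (simp add: singular_values_def)
  moreover have "sigma_min A \<le> sqrt \<mu>"
    unfolding sigma_min_def using \<mu>(1) finite_singular_values by (intro Min_le) auto
  ultimately have "(sigma_min A)\<^sup>2 \<le> \<mu>"
    using \<mu>(2) by (metis power_mono real_sqrt_pow2 less_imp_le)
  then have "(sigma_min A)\<^sup>2 * (norm e)\<^sup>2 \<le> \<mu> * (norm e)\<^sup>2"
    by (simp add: mult_right_mono)
  also have "\<dots> \<le> e \<bullet> (transpose A *v (A *v e))"
    by (rule le [OF assms(2)])
  finally show ?thesis
    by (simp only: norm_matrix_vector_mult_squared matrix_vector_mul_assoc)
qed

text \<open>Minimizing the Rayleigh quotient of - A^T A yields the largest eigenvalue \<mu> of A^T
  A, whose root is a singular value when A is nonzero.\<close>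

lemma sigma_max_bound:
  fixes A :: "real^'n^'m"
  shows "(norm (A *v e))\<^sup>2 \<le> (sigma_max A)\<^sup>2 * (norm e)\<^sup>2"
proof (cases "A = 0")
  case False
  obtain v \<nu> where v: "norm v = 1" "- (transpose A *v (A *v v)) = \<nu> *\<^sub>R v"
    and le: "\<And>w. \<nu> * (norm w)\<^sup>2 \<le> w \<bullet> - (transpose A *v (A *v w))"
  proof (rule min_rayleigh_eigenvector [of UNIV "\<lambda>w. - (transpose A *v (A *v w))"])
    show "linear (\<lambda>w. - (transpose A *v (A *v w)))"
      unfolding matrix_vector_mul_assoc by (intro linear_compose_neg matrix_vector_mul_linear)
    show "- (transpose A *v (A *v x)) \<bullet> y = x \<bullet> - (transpose A *v (A *v y))" for x y
      by (metis inner_commute inner_matrix_vector_mult transpose_transpose inner_minus_left)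
    show "(UNIV :: (real^'n) set) \<noteq> {0}"
      using UNIV_not_singleton by blast
  qed auto
  define \<mu> where "\<mu> = - \<nu>"
  have le': "(norm (A *v w))\<^sup>2 \<le> \<mu> * (norm w)\<^sup>2" for w
    using le [of w]
    by (simp add: \<mu>_def norm_matrix_vector_mult_squared matrix_vector_mul_assoc
        del: transpose_matrix_vector)
  have v': "transpose A *v (A *v v) = \<mu> *\<^sub>R v"
    using v(2) by (simp add: \<mu>_def neg_eq_iff_add_eq_0 eq_neg_iff_add_eq_0 del: transpose_matrix_vector)
  have "A *v v \<noteq> 0"
  proof
    assume "A *v v = 0"
    with v' v(1) have "\<mu> = 0" by auto
    with le' have "A = 0" by (simp add: matrix_eq)
    with False show False by simp
  qed
  with v(1) v' have \<mu>: "sqrt \<mu> \<in> singular_values A - {0}" "\<mu> > 0"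
    using singular_value_of_gram_eigenvector by blast+
  have "sqrt \<mu> \<le> sigma_max A"
    unfolding sigma_max_def using \<mu>(1) finite_singular_values by (intro Max_ge) auto
  then have "\<mu> \<le> (sigma_max A)\<^sup>2"
    using \<mu>(2) by (simp add: sqrt_le_D)
  then have "\<mu> * (norm e)\<^sup>2 \<le> (sigma_max A)\<^sup>2 * (norm e)\<^sup>2"
    by (simp add: mult_right_mono)
  with le' [of e] show ?thesis by linarith
qed simp

section \<open>Independence of the current state and the fresh sample\<close>

context prob_space begin

text \<open>
  The state \<open>Z k\<close> is a measurable function of \<open>X 1, \<dots>, X (k - 1)\<close> only. The maps \<open>g\<close> and \<open>h\<close>
  are there because \<open>indep_var\<close> requires both variables to have values in the same type.
\<close>

lemma indep_var_markov_state:
  fixes X :: "nat \<Rightarrow> 'a \<Rightarrow> 'b" and Z :: "nat \<Rightarrow> 'a \<Rightarrow> 'c"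
  assumes indep: "indep_vars (\<lambda>_. N) X {1..}"
    and F: "case_prod F \<in> measurable (N \<Otimes>\<^sub>M S) S"
    and z: "z \<in> space S" and Z1: "\<And>w. w \<in> space M \<Longrightarrow> Z 1 w = z"
    and step: "\<And>k w. 1 \<le> k \<Longrightarrow> w \<in> space M \<Longrightarrow> Z (Suc k) w = F (X k w) (Z k w)"
    and k: "1 \<le> k" and g: "g \<in> measurable N L" and h: "h \<in> measurable S L"
  shows "indep_var L (\<lambda>w. g (X k w)) L (\<lambda>w. h (Z k w))"
proof -
  \<comment> \<open>\<open>f j\<close> computes the state with index \<open>Suc j\<close> from the
    samples 1, ..., j; the shift reflects that states start at index 1.\<close>
  define f where "f = rec_nat (\<lambda>_. z) (\<lambda>j g x. F (x (Suc j)) (g x))"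
  have f0: "f 0 = (\<lambda>_. z)" and fS: "\<And>j. f (Suc j) = (\<lambda>x. F (x (Suc j)) (f j x))"
    by (simp_all add: f_def)
  have f_meas: "f j \<in> measurable (Pi\<^sub>M {1..<k} (\<lambda>_. N)) S" if "j < k" for j
    using that
  proof (induction j)
    case 0
    show ?case using z by (simp add: f0)
  next
    case (Suc j)
    have "(\<lambda>x. x (Suc j)) \<in> measurable (Pi\<^sub>M {1..<k} (\<lambda>_. N)) N"
      using Suc by (intro measurable_component_singleton) auto
    with Suc have "(\<lambda>x. (x (Suc j), f j x)) \<in> measurable (Pi\<^sub>M {1..<k} (\<lambda>_. N)) (N \<Otimes>\<^sub>M S)"
      by (intro measurable_Pair) auto
    from measurable_compose [OF this F] show ?case by (simp add: fS)
  qed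
  have Z: "Z (Suc j) w = f j (\<lambda>i\<in>{1..<k}. X i w)" if "w \<in> space M" "j < k" for j w
    using that by (induction j) (simp_all add: Z1 [simplified] step f0 fS)
  \<comment> \<open>The blocks {k} and {1..<k} are disjoint, so the fresh sample is independent of
    everything entering the current state.\<close>
  have "indep_var (Pi\<^sub>M {k} (\<lambda>_. N)) (\<lambda>w. \<lambda>i\<in>{k}. X i w)
     (Pi\<^sub>M {1..<k} (\<lambda>_. N)) (\<lambda>w. \<lambda>i\<in>{1..<k}. X i w)"
    using k by (intro indep_var_restrict [OF indep]) auto
  then have "indep_var L ((\<lambda>x. g (x k)) \<circ> (\<lambda>w. \<lambda>i\<in>{k}. X i w))
     L ((\<lambda>x. h (f (k - 1) x)) \<circ> (\<lambda>w. \<lambda>i\<in>{1..<k}. X i w))"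
  proof (rule indep_var_compose)
    show "(\<lambda>x. g (x k)) \<in> measurable (Pi\<^sub>M {k} (\<lambda>_. N)) L"
      using g by (intro measurable_compose [OF measurable_component_singleton]) auto
    show "(\<lambda>x. h (f (k - 1) x)) \<in> measurable (Pi\<^sub>M {1..<k} (\<lambda>_. N)) L"
      using k h by (intro measurable_compose [OF f_meas]) auto
  qed
  moreover have "f (k - 1) (\<lambda>i\<in>{1..<k}. X i w) = Z k w" if "w \<in> space M" for w
    using Z [OF that, of "k - 1"] k by simp
  ultimately show ?thesis
    by (auto simp: indep_var_eq cong: measurable_cong vimage_inter_cong)
qed

text \<open>Written out in entries, the form is a finite sum of products of an entry of
  \<open>G\<close> with some u_i v_j, and independence of each such pair lets the expectation
  factor. Square integrability of \<open>u\<close> and \<open>v\<close> makes u_i v_j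
  integrable.\<close>

lemma indep_matrix_form:
  fixes G :: "'a \<Rightarrow> real^'n^'m" and u :: "'a \<Rightarrow> real^'m" and v :: "'a \<Rightarrow> real^'n"
  assumes indep: "\<And>i j. indep_var borel (\<lambda>w. G w $ i $ j) borel (\<lambda>w. u w $ i * v w $ j)"
    and G: "integrable M G"
    and u: "integrable M (\<lambda>w. (norm (u w))\<^sup>2)" and v: "integrable M (\<lambda>w. (norm (v w))\<^sup>2)"
  shows "integrable M (\<lambda>w. u w \<bullet> (G w *v v w))" (is ?int)
    and "integrable M (\<lambda>w. u w \<bullet> (B *v v w))" (is ?int')
    and "expectation (\<lambda>w. u w \<bullet> (G w *v v w)) = expectation (\<lambda>w. u w \<bullet> (expectation G *v v w))" (is ?eq)
proof -
  have Gij: "integrable M (\<lambda>w. G w $ i $ j)" "expectation (\<lambda>w. G w $ i $ j) = expectation G $ i $ j" for i j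
  proof -
    have bl: "bounded_linear (\<lambda>B :: real^'n^'m. B $ i $ j)"
      using bounded_linear_compose [OF bounded_linear_vec_nth bounded_linear_vec_nth] .
    show "integrable M (\<lambda>w. G w $ i $ j)"
      by (rule integrable_bounded_linear [OF bl G])
    show "expectation (\<lambda>w. G w $ i $ j) = expectation G $ i $ j"
      by (rule integral_bounded_linear [OF bl G])
  qed
  have uv: "integrable M (\<lambda>w. u w $ i * v w $ j)" for i j
  proof (rule Bochner_Integration.integrable_bound)
    show "integrable M (\<lambda>w. (norm (u w))\<^sup>2 + (norm (v w))\<^sup>2)"
      using u v by simp
    show "(\<lambda>w. u w $ i * v w $ j) \<in> borel_measurable M"
      using indep by (rule indep_var_rv2)
    have "\<bar>u w $ i * v w $ j\<bar> \<le> (norm (u w))\<^sup>2 + (norm (v w))\<^sup>2" for w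
    proof -
      have "\<bar>u w $ i * v w $ j\<bar> \<le> norm (u w) * norm (v w)"
        unfolding abs_mult by (intro mult_mono component_le_norm_cart) auto
      also have "\<dots> \<le> (norm (u w))\<^sup>2 + (norm (v w))\<^sup>2"
        using sum_squares_bound [of "norm (u w)" "norm (v w)"]
          mult_nonneg_nonneg [OF norm_ge_zero norm_ge_zero, of "u w" "v w"] by linarith
      finally show ?thesis .
    qed
    then show "AE w in M. norm (u w $ i * v w $ j) \<le> norm ((norm (u w))\<^sup>2 + (norm (v w))\<^sup>2)"
      by (auto intro: order_trans [OF _ abs_ge_self])
  qed
  have form: "x \<bullet> (B *v y) = (\<Sum>i\<in>UNIV. \<Sum>j\<in>UNIV. B $ i $ j * (x $ i * y $ j))"
    for x and B :: "real^'n^'m" and y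
    by (simp add: inner_vec_def matrix_vector_mult_def sum_distrib_left mult_ac)
  show ?int
    unfolding form by (intro Bochner_Integration.integrable_sum indep_var_integrable indep Gij uv)
  show ?int'
    unfolding form by (intro Bochner_Integration.integrable_sum integrable_mult_right uv)
  show ?eq
    unfolding form
    by (simp add: Bochner_Integration.integral_sum indep_var_integrable [OF indep Gij(1) uv]
        indep_var_lebesgue_integral [OF indep Gij(1) uv] Gij(2) uv)
qed

end

section \<open>Two-term recurrences\<close>

text \<open>\<open>q\<close> is the larger root of t^2 - c1 t - c2. This polynomial is nonpositive
  at c1 + c2, where it equals c2 (c1 + c2 - 1), and positive at 1, which lies to the right of its
  vertex.\<close>

lemma characteristic_root:
  fixes c1 c2 q :: real
  assumes "0 \<le> c2" "c1 + c2 < 1" and q: "q = (c1 + sqrt (c1\<^sup>2 + 4 * c2)) / 2"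
  shows "q - c1 \<ge> 0" "q * (q - c1) = c2" "c1 + c2 \<le> q" "q < 1"
proof -
  let ?r = "sqrt (c1\<^sup>2 + 4 * c2)"
  have r2: "?r\<^sup>2 = c1\<^sup>2 + 4 * c2" using assms by simp
  have "\<bar>c1\<bar> \<le> ?r" using assms by (intro real_le_rsqrt) simp
  then show "q - c1 \<ge> 0" by (simp add: q)
  show "q * (q - c1) = c2" using r2 by (simp add: q power2_eq_square algebra_simps)
  \<comment> \<open>Exactly what (c1 + 2 c2)^2 \<le> c1^2 + 4 c2 amounts to.\<close>
  have "c2 * (c1 + c2) \<le> c2 * 1" using assms by (intro mult_left_mono) auto
  then have "c1 + 2 * c2 \<le> ?r"
    by (intro real_le_rsqrt) (simp add: power2_eq_square algebra_simps)
  then show "c1 + c2 \<le> q" by (simp add: q)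
  have "?r < 2 - c1"
    using assms by (intro real_less_lsqrt) (auto simp: power2_eq_square algebra_simps)
  then show "q < 1" by (simp add: q)
qed

text \<open>
  The rate \<open>q\<close> may be negative; nonnegativity of \<open>F\<close> then forces the sequence to vanish.
\<close>

lemma two_term_recurrence_bound:
  fixes F :: "nat \<Rightarrow> real"
  assumes F: "\<And>k. 0 \<le> F k" and rec: "\<And>k. F (Suc (Suc k)) \<le> c1 * F (Suc k) + c2 * F k"
    and init: "F 1 = F 0" and t: "0 \<le> t" "t = q - c1" "q * t = c2"
  shows "F (Suc k) \<le> q ^ k * (1 + t) * F 0"
proof -
  define H where "H k = F (Suc k) + t * F k" for k
  have H_ge: "F (Suc k) \<le> H k" "0 \<le> H k" for k
    using F [of k] F [of "Suc k"] t by (auto simp: H_def)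
  have H_step: "H (Suc k) \<le> q * H k" for k
  proof -
    have "H (Suc k) \<le> (c1 + t) * F (Suc k) + (q * t) * F k"
      using rec [of k] by (simp add: H_def t(3) algebra_simps)
    also have "\<dots> = q * H k" using t by (simp add: H_def algebra_simps)
    finally show ?thesis .
  qed
  have "H k \<le> q ^ k * H 0"
  proof (cases "q \<ge> 0")
    case True
    show ?thesis
    proof (induction k)
      case (Suc k)
      have "H (Suc k) \<le> q * (q ^ k * H 0)"
        using H_step [of k] mult_left_mono [OF Suc True] by linarith
      then show ?case by (simp add: mult.assoc)
    qed simp
  next
    case False
    have "H j = 0" for j
    proof -
      have "0 \<le> q * H j" using H_ge(2) [of "Suc j"] H_step [of j] by linarith
      with False H_ge(2) [of j] show ?thesis by (simp add: zero_le_mult_iff)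
    qed
    then show ?thesis by simp
  qed
  \<comment> \<open>The equal starting values are the source of the factor 1 + t.\<close>
  also have "H 0 = (1 + t) * F 0" using init by (simp add: H_def algebra_simps)
  finally show ?thesis using H_ge(1) [of k] by (simp add: mult.assoc)
qed

section \<open>One step of the iteration\<close>

lemma frob_norm_pos:
  fixes A :: "real^'n^'m"
  assumes "A \<noteq> 0"
  shows "0 < frob_norm A"
proof -
  have "frob_norm A = norm A"
    by (simp add: frob_norm_def norm_vec_def L2_set_def sum_nonneg)
  with assms show ?thesis by simp
qed

lemma mat_mult_scaleR:
  fixes B :: "real^'n^'m"
  shows "mat c ** B = c *\<^sub>R B"
  by (simp add: matrix_matrix_mult_def mat_def vec_eq_iff if_distrib if_distribR cong: if_cong)

lemma transpose_mult_transpose: "transpose (mult_transpose p S R) = mult_transpose p R S"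
  by (simp add: transpose_def mult_transpose_def vec_eq_iff mult.commute)

lemma step_matrix_scalar:
  fixes A :: "real^'n^'m"
  assumes "0 \<le> \<rho>"
  shows "step_matrix A (p, S1, S2, mat (sqrt \<rho>), mat (sqrt \<rho>)) =
    \<rho> *\<^sub>R (transpose A ** mult_transpose p S1 S2)"
proof -
  have "mat (sqrt \<rho>) ** mat (sqrt \<rho>) = (mat \<rho> :: real^'n^'n)"
    unfolding mat_mult_scaleR using assms by (simp add: mat_def vec_eq_iff)
  then have "step_matrix A (p, S1, S2, mat (sqrt \<rho>), mat (sqrt \<rho>)) =
      mat \<rho> ** (transpose A ** mult_transpose p S1 S2)"
    by (simp add: matrix_mul_assoc)
  then show ?thesis by (simp only: mat_mult_scaleR)
qed

text \<open>With M = S1 S2^T the step matrix is \<rho> A^T M, and transposing M swaps S1 and S2.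
  This is how the matrix behind \<beta>3 enters.\<close>

lemma norm_step_matrix_scalar:
  fixes A :: "real^'n^'m"
  assumes "0 \<le> \<rho>"
  shows "(norm (step_matrix A (p, S1, S2, mat (sqrt \<rho>), mat (sqrt \<rho>)) *v y))\<^sup>2 =
    \<rho>\<^sup>2 * (y \<bullet> (second_moment_matrix A (p, S1, S2, mat (sqrt \<rho>), mat (sqrt \<rho>)) *v y))"
  unfolding step_matrix_scalar [OF assms] scaleR_matrix_vector_assoc [symmetric] norm_scaleR
    power_mult_distrib power2_abs norm_matrix_vector_mult_squared
  by (simp add: matrix_transpose_mul transpose_mult_transpose matrix_mul_assoc)

text \<open>The gap between the two sides is exactly (\<omega> + \<omega>^2) |a + c|^2.\<close>

lemma norm_heavy_ball_le:
  fixes a c :: "'a::real_inner"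
  assumes "0 \<le> \<omega>"
  shows "(norm (a + \<omega> *\<^sub>R (a - c)))\<^sup>2 \<le>
    (1 + 3 * \<omega> + 2 * \<omega>\<^sup>2) * (norm a)\<^sup>2 + (2 * \<omega>\<^sup>2 + \<omega>) * (norm c)\<^sup>2"
proof -
  have "(1 + 3 * \<omega> + 2 * \<omega>\<^sup>2) * (norm a)\<^sup>2 + (2 * \<omega>\<^sup>2 + \<omega>) * (norm c)\<^sup>2
      - (norm (a + \<omega> *\<^sub>R (a - c)))\<^sup>2 = (\<omega> + \<omega>\<^sup>2) * (norm (a + c))\<^sup>2"
    unfolding power2_norm_eq_inner
    by (simp add: inner_add inner_diff inner_commute [of c a] power2_eq_square distrib_left
        distrib_right left_diff_distrib right_diff_distrib)
  moreover have "0 \<le> (\<omega> + \<omega>\<^sup>2) * (norm (a + c))\<^sup>2"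
    using assms by simp
  ultimately show ?thesis by linarith
qed

text \<open>The deterministic core: \<open>a\<close> and \<open>c\<close> are the current and
  previous error, \<phi> is the squared Frobenius norm, \<kappa> is \<alpha>^2 \<rho>^2 \<beta>3
  \<phi>, and \<open>B\<close> is the second-moment term.\<close>

lemma momentum_step_bound:
  fixes A :: "real^'n^'m" and a c :: "real^'n" and \<alpha> \<omega> \<kappa> B \<phi> :: real
  assumes A: "A \<noteq> 0" and a: "a \<in> range ((*v) (transpose A))"
    and \<alpha>: "0 \<le> \<alpha>" "\<kappa> \<le> 2 * \<alpha>" and \<omega>: "0 \<le> \<omega>" and \<phi>: "0 < \<phi>"
    and B: "\<phi> * B \<le> \<kappa> * (norm (A *v a))\<^sup>2"
  shows "(norm (a + \<omega> *\<^sub>R (a - c)))\<^sup>2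
      - 2 * \<alpha> * ((A *v (a + \<omega> *\<^sub>R (a - c))) \<bullet> (A *v a)) / \<phi> + B
    \<le> (1 + 3 * \<omega> + 2 * \<omega>\<^sup>2 - (2 * \<alpha> - \<kappa> + \<alpha> * \<omega>) * ((sigma_min A)\<^sup>2 / \<phi>)) * (norm a)\<^sup>2
      + (2 * \<omega>\<^sup>2 + \<omega> + \<omega> * \<alpha> * ((sigma_max A)\<^sup>2 / \<phi>)) * (norm c)\<^sup>2"
proof -
  let ?a = "(norm (A *v a))\<^sup>2" and ?c = "(norm (A *v c))\<^sup>2"
  let ?s = "2 * \<alpha> - \<kappa> + \<alpha> * \<omega>"
  \<comment> \<open>Used as 2 <A a, A c> \<le> |A a|^2 + |A c|^2 to remove the mixed term caused by
    momentum.\<close>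
  have "0 \<le> \<alpha> * \<omega> * (norm (A *v a - A *v c))\<^sup>2"
    using \<alpha> \<omega> by simp
  then have "- 2 * \<alpha> * ((A *v (a + \<omega> *\<^sub>R (a - c))) \<bullet> (A *v a))
      \<le> - (2 * \<alpha> + \<alpha> * \<omega>) * ?a + \<omega> * \<alpha> * ?c"
    by (simp add: power2_norm_eq_inner inner_add inner_diff inner_commute [of "A *v c" "A *v a"]
        matrix_vector_mult_scaleR algebra_simps)
  then have "\<phi> * B - 2 * \<alpha> * ((A *v (a + \<omega> *\<^sub>R (a - c))) \<bullet> (A *v a))
      \<le> - ?s * ?a + \<omega> * \<alpha> * ?c"
    using B by (simp add: algebra_simps)
  also have "\<dots> \<le> - ?s * ((sigma_min A)\<^sup>2 * (norm a)\<^sup>2) + \<omega> * \<alpha> * ((sigma_max A)\<^sup>2 * (norm c)\<^sup>2)"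
  proof (rule add_mono)
    \<comment> \<open>Here \<kappa> \<le> 2 \<alpha> matters: the lower bound on |A a| may only be
      inserted with a nonpositive coefficient.\<close>
    have "0 \<le> ?s" using \<alpha> \<omega> by simp
    then show "- ?s * ?a \<le> - ?s * ((sigma_min A)\<^sup>2 * (norm a)\<^sup>2)"
      using mult_left_mono [OF sigma_min_bound [OF A a], of ?s]
      by (simp only: mult_minus_left neg_le_iff_le)
    show "\<omega> * \<alpha> * ?c \<le> \<omega> * \<alpha> * ((sigma_max A)\<^sup>2 * (norm c)\<^sup>2)"
      using \<alpha> \<omega> by (intro mult_left_mono sigma_max_bound) simp
  qed
  finally have "(\<phi> * B - 2 * \<alpha> * ((A *v (a + \<omega> *\<^sub>R (a - c))) \<bullet> (A *v a))) / \<phi>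
      \<le> (- ?s * ((sigma_min A)\<^sup>2 * (norm a)\<^sup>2) + \<omega> * \<alpha> * ((sigma_max A)\<^sup>2 * (norm c)\<^sup>2)) / \<phi>"
    using \<phi> by (simp add: divide_right_mono)
  moreover have "(\<phi> * B - 2 * \<alpha> * ((A *v (a + \<omega> *\<^sub>R (a - c))) \<bullet> (A *v a))) / \<phi>
      = B - 2 * \<alpha> * ((A *v (a + \<omega> *\<^sub>R (a - c))) \<bullet> (A *v a)) / \<phi>"
    using \<phi> by (simp add: diff_divide_distrib)
  moreover note norm_heavy_ball_le [OF \<omega>, of a c]
  ultimately show ?thesis
    by (simp add: algebra_simps add_divide_distrib diff_divide_distrib)
qed

section \<open>Measurability and quadratic forms of matrices\<close>

lemma measurable_matrix_vector_mult [measurable]: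
  fixes f :: "'a \<Rightarrow> real^'n^'m" and g :: "'a \<Rightarrow> real^'n"
  assumes "f \<in> borel_measurable M" "g \<in> borel_measurable M"
  shows "(\<lambda>w. f w *v g w) \<in> borel_measurable M"
proof (rule borel_measurable_continuous_Pair [OF assms])
  show "continuous_on UNIV (\<lambda>x. fst x *v snd x :: real^'m)"
    unfolding matrix_vector_mult_def by (intro continuous_intros)
qed

lemma measurable_vec_nth [measurable]:
  fixes f :: "'a \<Rightarrow> 'b::real_normed_vector^'n"
  assumes "f \<in> borel_measurable M"
  shows "(\<lambda>w. f w $ i) \<in> borel_measurable M"
  using assms by (rule borel_measurable_continuous_on [rotated]) (intro continuous_intros)

lemma quadratic_form_le_onorm:
  fixes K :: "real^'n^'n"
  shows "y \<bullet> (K *v y) \<le> onorm ((*v) K) * (norm y)\<^sup>2"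
proof -
  have "y \<bullet> (K *v y) \<le> norm y * norm (K *v y)"
    by (rule norm_cauchy_schwarz)
  also have "\<dots> \<le> norm y * (onorm ((*v) K) * norm y)"
    by (intro mult_left_mono onorm) auto
  finally show ?thesis by (simp add: power2_eq_square mult_ac)
qed

section \<open>Convergence rate in mean square\<close>

theorem theorem4p7:
  fixes A :: "real^'n^'m" and b :: "real^'m" and x0 xstar :: "real^'n"
    and \<rho> \<alpha> \<omega> \<beta>3 \<gamma>1 \<gamma>2 q \<tau> :: real
    and D :: "('m, 'n) sample measure"
    and M :: "'w measure"
    and \<xi> :: "nat \<Rightarrow> 'w \<Rightarrow> ('m, 'n) sample"
    and x :: "nat \<Rightarrow> 'w \<Rightarrow> real^'n"
  assumes "A \<noteq> 0" and "\<exists>z. A *v z = b" and "\<rho> > 0"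
    and "prob_space D" and "sets D = sets borel"
    and "AE (p, S1, S2, T1, T2) in D. T1 = mat (sqrt \<rho>) \<and> T2 = mat (sqrt \<rho>)"
    and "integrable D (step_matrix A)"
    and "integral\<^sup>L D (step_matrix A) = (1 / (frob_norm A)\<^sup>2) *\<^sub>R transpose A"
    and "integrable D (second_moment_matrix A)"
    and "prob_space M"
    and "prob_space.indep_vars M (\<lambda>_. borel) \<xi> {1..}"
    and "\<And>k. k \<ge> 1 \<Longrightarrow> distr M borel (\<xi> k) = D"
    and "\<And>w. w \<in> space M \<Longrightarrow> x 0 w = x0"
    and "\<And>w. w \<in> space M \<Longrightarrow> x 1 w = x0"
    and "\<And>k w. k \<ge> 1 \<Longrightarrow> w \<in> space M \<Longrightarrow>
           x (k + 1) w = x k w - \<alpha> *\<^sub>R (step_matrix A (\<xi> k w) *v (A *v x k w - b))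
                         + \<omega> *\<^sub>R (x k w - x (k - 1) w)"
    and "xstar = pinv A *v b + (mat 1 - pinv A ** A) *v x0"
    and "\<beta>3 = onorm ((*v) (integral\<^sup>L D (second_moment_matrix A)))"
    and "0 < \<alpha>" and "\<alpha> < 2 / (\<rho>\<^sup>2 * \<beta>3 * (frob_norm A)\<^sup>2)" and "\<omega> \<ge> 0"
    and "\<gamma>1 = 1 + 3 * \<omega> + 2 * \<omega>\<^sup>2
               - (2 * \<alpha> - \<alpha>\<^sup>2 * \<rho>\<^sup>2 * \<beta>3 * (frob_norm A)\<^sup>2 + \<alpha> * \<omega>)
                 * ((sigma_min A)\<^sup>2 / (frob_norm A)\<^sup>2)"
    and "\<gamma>2 = 2 * \<omega>\<^sup>2 + \<omega> + \<omega> * \<alpha> * ((sigma_max A)\<^sup>2 / (frob_norm A)\<^sup>2)"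
    and "\<gamma>1 + \<gamma>2 < 1"
    and "q = (if \<omega> > 0 then (\<gamma>1 + sqrt (\<gamma>1\<^sup>2 + 4 * \<gamma>2)) / 2 else \<gamma>1)"
    and "\<tau> = q - \<gamma>1"
  shows "(\<forall>k. integrable M (\<lambda>w. (norm (x (k + 1) w - xstar))\<^sup>2) \<and>
              (\<integral>w. (norm (x (k + 1) w - xstar))\<^sup>2 \<partial>M)
                \<le> q ^ k * (1 + \<tau>) * (norm (x0 - xstar))\<^sup>2)
         \<and> \<tau> \<ge> 0 \<and> \<gamma>1 + \<gamma>2 \<le> q \<and> q < 1"
proof -
  note A = assms(1) and consistent = assms(2) and \<rho> = assms(3) and D_sets = assms(5)
    and scalar = assms(6) and G_int = assms(7) and G_mean = assms(8) and K_int = assms(9)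
    and indep = assms(11) and distr = assms(12) and x_0 = assms(13) and x_1 = assms(14)
    and x_Suc = assms(15) and xstar = assms(16) and \<beta>3 = assms(17) and \<alpha> = assms(18,19)
    and \<omega> = assms(20) and \<gamma>1 = assms(21) and \<gamma>2 = assms(22) and \<gamma>_sum = assms(23)
    and q = assms(24) and \<tau> = assms(25)
  interpret prob_space M by fact
  define \<phi> where "\<phi> = (frob_norm A)\<^sup>2"
  define K where "K = integral\<^sup>L D (second_moment_matrix A)"
  define G where "G k w = step_matrix A (\<xi> k w)" for k w
  define S where "S k w = second_moment_matrix A (\<xi> k w)" for k w
  define e where "e k w = x k w - xstar" for k w
  let ?W = "range ((*v) (transpose A))"

  have \<phi>: "\<phi> > 0"
    using frob_norm_pos [OF A] by (simp add: \<phi>_def)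
  \<comment> \<open>As division by 0 gives 0, the bounds on \<alpha> force the denominator, and with
    it \<beta>3, to be positive.\<close>
  have "0 < 2 / (\<rho>\<^sup>2 * \<beta>3 * \<phi>)"
    using order.strict_trans [OF \<alpha>] by (simp only: \<phi>_def)
  then have "0 < \<rho>\<^sup>2 * \<beta>3 * \<phi>"
    by (simp add: zero_less_divide_iff)
  with \<alpha>(2) have "\<alpha> * (\<rho>\<^sup>2 * \<beta>3 * \<phi>) \<le> 2"
    unfolding \<phi>_def [symmetric] by (simp add: less_divide_eq)
  then have \<kappa>: "\<alpha>\<^sup>2 * \<rho>\<^sup>2 * \<beta>3 * \<phi> \<le> 2 * \<alpha>"
    using mult_left_mono [of _ 2 \<alpha>] \<alpha>(1) by (simp add: power2_eq_square mult_ac)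

  \<comment> \<open>A annihilates the part of \<open>xstar\<close> involving \<open>x0\<close>, and
    consistency gives A pinv(A) b = b.\<close>
  have A_xstar: "A *v xstar = b"
  proof -
    obtain z where z: "A *v z = b" using consistent by blast
    have "A *v (pinv A *v (A *v y)) = A *v y" for y
      by (simp add: matrix_vector_mul_assoc matrix_mul_assoc [symmetric] pinv_penrose)
        (simp add: matrix_mul_assoc pinv_penrose)
    then show ?thesis
      unfolding xstar z [symmetric]
      by (simp add: matrix_vector_mult_diff_rdistrib matrix_vector_mult_diff_distrib
          matrix_vector_right_distrib flip: matrix_vector_mul_assoc)
  qed
  have e_init: "x0 - xstar \<in> ?W"
  proof -
    have "x0 - xstar = pinv A *v (A *v x0 - b)"
      unfolding xstar
      by (simp add: matrix_vector_mult_diff_rdistrib matrix_vector_mult_diff_distrib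
          flip: matrix_vector_mul_assoc)
    then show ?thesis using pinv_in_row_space by metis
  qed
  have e_0: "e 0 w = x0 - xstar" and e_1: "e (Suc 0) w = x0 - xstar" if "w \<in> space M" for w
    using x_0 x_1 that by (simp_all add: e_def)
  have e_Suc: "e (Suc k) w = e k w + \<omega> *\<^sub>R (e k w - e (k - 1) w) - \<alpha> *\<^sub>R (G k w *v (A *v e k w))"
    if "1 \<le> k" "w \<in> space M" for k w
  proof -
    have "A *v e k w = A *v x k w - b"
      by (simp add: e_def matrix_vector_mult_diff_distrib A_xstar)
    then show ?thesis
      using x_Suc [OF that] by (simp add: e_def G_def)
  qed

  have \<xi>_meas: "\<xi> k \<in> measurable M borel" if "1 \<le> k" for k
    using indep that by (simp add: indep_vars_def)
  have step_meas [measurable]: "step_matrix A \<in> borel_measurable borel"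
    using borel_measurable_integrable [OF G_int] D_sets by (simp cong: measurable_cong_sets)
  have second_meas [measurable]: "second_moment_matrix A \<in> borel_measurable borel"
    using borel_measurable_integrable [OF K_int] D_sets by (simp cong: measurable_cong_sets)
  \<comment> \<open>Each sample has law \<open>D\<close>, so moments transfer from \<open>D\<close>
    to \<open>M\<close>.\<close>
  have G: "integrable M (G k)" "expectation (G k) = (1 / \<phi>) *\<^sub>R transpose A"
    and S: "integrable M (S k)" "expectation (S k) = K" if "1 \<le> k" for k
    using integrable_distr [OF \<xi>_meas [OF that], of "step_matrix A"]
      integrable_distr [OF \<xi>_meas [OF that], of "second_moment_matrix A"]
      integral_distr [OF \<xi>_meas [OF that] step_meas]
      integral_distr [OF \<xi>_meas [OF that] second_meas]
      G_int G_mean K_int distr [OF that]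
    by (simp_all add: G_def [abs_def] S_def [abs_def] K_def \<phi>_def)
  \<comment> \<open>The scalar form of T1 and T2 holds only almost surely. The quantifier over
    \<open>y\<close> stays inside so that random vectors may be inserted later.\<close>
  have G_AE: "AE w in M. (\<forall>y. (norm (G k w *v y))\<^sup>2 = \<rho>\<^sup>2 * (y \<bullet> (S k w *v y)))
      \<and> (\<forall>y. G k w *v y \<in> ?W)" if "1 \<le> k" for k
  proof -
    have "AE s in D. (\<forall>y. (norm (step_matrix A s *v y))\<^sup>2 = \<rho>\<^sup>2 * (y \<bullet> (second_moment_matrix A s *v y)))
      \<and> (\<forall>y. step_matrix A s *v y \<in> ?W)"
      using scalar
    proof eventually_elim
      case (elim s)
      then obtain p S1 S2 where s: "s = (p, S1, S2, mat (sqrt \<rho>), mat (sqrt \<rho>))"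
        by (cases s) auto
      have "step_matrix A s *v y \<in> ?W" for y
      proof
        show "step_matrix A s *v y = transpose A *v (\<rho> *\<^sub>R (mult_transpose p S1 S2 *v y))"
          using \<rho> unfolding s
          by (subst step_matrix_scalar) (simp_all add: scaleR_matrix_vector_assoc [symmetric]
              matrix_vector_mult_scaleR matrix_vector_mul_assoc [symmetric] del: transpose_matrix_vector)
      qed simp
      moreover have "(norm (step_matrix A s *v y))\<^sup>2 = \<rho>\<^sup>2 * (y \<bullet> (second_moment_matrix A s *v y))" for y
        using \<rho> unfolding s by (intro norm_step_matrix_scalar) simp
      ultimately show ?case by blast
    qed
    then show ?thesis
      unfolding distr [OF that, symmetric] G_def S_def by (rule AE_distrD [OF \<xi>_meas [OF that]])
  qed

  \<comment> \<open>Pairing consecutive errors turns the two-term recursion into a one-step Markov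
    recursion.\<close>
  let ?F = "\<lambda>s z. (fst z + \<omega> *\<^sub>R (fst z - snd z) - \<alpha> *\<^sub>R (step_matrix A s *v (A *v fst z)), fst z)"
  have F_meas: "case_prod ?F \<in> measurable (borel \<Otimes>\<^sub>M (borel \<Otimes>\<^sub>M borel)) (borel \<Otimes>\<^sub>M borel)"
    unfolding split_beta' by measurable
  have form_indep: "indep_var borel (\<lambda>w. g (\<xi> k w)) borel (\<lambda>w. h (e k w, e (k - 1) w))"
    if "1 \<le> k" "g \<in> borel_measurable borel" "h \<in> borel_measurable (borel \<Otimes>\<^sub>M borel)"
    for k and g :: "('m, 'n) sample \<Rightarrow> real" and h
    using that e_0 e_1
    by (intro indep_var_markov_state [OF indep F_meas,
          where Z = "\<lambda>k w. (e k w, e (k - 1) w)" and z = "(x0 - xstar, x0 - xstar)"])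
      (auto simp: space_pair_measure e_Suc G_def)

  have e_meas: "e k \<in> borel_measurable M \<and> e (Suc k) \<in> borel_measurable M" for k
  proof (induction k)
    case 0
    have "e 0 \<in> borel_measurable M" "e (Suc 0) \<in> borel_measurable M"
      by (simp_all add: e_0 e_1 cong: measurable_cong)
    then show ?case by simp
  next
    case (Suc k)
    then have [measurable]: "e k \<in> borel_measurable M" "e (Suc k) \<in> borel_measurable M"
      by simp_all
    have [measurable]: "\<xi> (Suc k) \<in> measurable M borel"
      by (rule \<xi>_meas) simp
    have "(\<lambda>w. e (Suc k) w + \<omega> *\<^sub>R (e (Suc k) w - e k w)
        - \<alpha> *\<^sub>R (step_matrix A (\<xi> (Suc k) w) *v (A *v e (Suc k) w))) \<in> borel_measurable M"
      by measurable
    then have "e (Suc (Suc k)) \<in> borel_measurable M"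
      by (rule measurable_cong [THEN iffD1, rotated]) (simp add: e_Suc G_def)
    with Suc show ?case by simp
  qed

  \<comment> \<open>Both the momentum combination and the almost sure range of \<open>G\<close> stay
    in the row space.\<close>
  have e_W: "(AE w in M. e k w \<in> ?W) \<and> (AE w in M. e (Suc k) w \<in> ?W)" for k
  proof (induction k)
    case 0
    have "AE w in M. e 0 w \<in> ?W" "AE w in M. e (Suc 0) w \<in> ?W"
      using e_init by (auto simp: e_0 e_1 simp del: transpose_matrix_vector intro!: AE_I2)
    then show ?case by simp
  next
    case (Suc k)
    have W: "subspace ?W"
      by (rule linear_subspace_image) (simp_all del: transpose_matrix_vector)
    have "AE w in M. e k w \<in> ?W" "AE w in M. e (Suc k) w \<in> ?W"
      using Suc by simp_all
    moreover have "AE w in M. w \<in> space M" by simp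
    moreover have "AE w in M. \<forall>y. G (Suc k) w *v y \<in> ?W"
      using G_AE [of "Suc k"] by (auto elim: eventually_mono)
    ultimately have "AE w in M. e (Suc (Suc k)) w \<in> ?W"
    proof eventually_elim
      case (elim w)
      then show ?case
        unfolding e_Suc [of "Suc k" w, simplified]
        by (simp only: e_Suc le_add1 plus_1_eq_Suc diff_Suc_1 subspace_add subspace_diff subspace_scale W)
    qed
    with Suc show ?case by simp
  qed

  \<comment> \<open>Mean-square recurrence for consecutive errors\<close>
  have step: "integrable M (\<lambda>w. (norm (e (Suc (Suc k)) w))\<^sup>2) \<and>
      expectation (\<lambda>w. (norm (e (Suc (Suc k)) w))\<^sup>2)
        \<le> \<gamma>1 * expectation (\<lambda>w. (norm (e (Suc k) w))\<^sup>2) + \<gamma>2 * expectation (\<lambda>w. (norm (e k w))\<^sup>2)"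
    if int: "integrable M (\<lambda>w. (norm (e k w))\<^sup>2)" "integrable M (\<lambda>w. (norm (e (Suc k) w))\<^sup>2)" for k
  proof -
    have k: "1 \<le> Suc k" by simp
    define a where "a = e (Suc k)"
    define c where "c = e k"
    define d where "d w = a w + \<omega> *\<^sub>R (a w - c w)" for w
    define y where "y w = A *v a w" for w
    note [simp] = a_def [symmetric] c_def [symmetric]
    have [measurable]: "a \<in> borel_measurable M" "c \<in> borel_measurable M"
      using e_meas [of k] by simp_all
    have [measurable]: "d \<in> borel_measurable M" "y \<in> borel_measurable M"
      unfolding d_def [abs_def] y_def [abs_def] by measurable
    have d_int: "integrable M (\<lambda>w. (norm (d w))\<^sup>2)"
    proof (rule Bochner_Integration.integrable_bound)
      show "integrable M (\<lambda>w. (1 + 3 * \<omega> + 2 * \<omega>\<^sup>2) * (norm (a w))\<^sup>2 + (2 * \<omega>\<^sup>2 + \<omega>) * (norm (c w))\<^sup>2)"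
        using int by simp
      show "AE w in M. norm ((norm (d w))\<^sup>2) \<le>
          norm ((1 + 3 * \<omega> + 2 * \<omega>\<^sup>2) * (norm (a w))\<^sup>2 + (2 * \<omega>\<^sup>2 + \<omega>) * (norm (c w))\<^sup>2)"
        unfolding d_def using norm_heavy_ball_le [OF \<omega>]
        by (auto intro!: AE_I2 intro: order_trans [OF _ abs_ge_self])
    qed measurable
    have y_int: "integrable M (\<lambda>w. (norm (y w))\<^sup>2)"
    proof (rule Bochner_Integration.integrable_bound)
      show "integrable M (\<lambda>w. (sigma_max A)\<^sup>2 * (norm (a w))\<^sup>2)"
        using int by simp
      show "AE w in M. norm ((norm (y w))\<^sup>2) \<le> norm ((sigma_max A)\<^sup>2 * (norm (a w))\<^sup>2)"
        unfolding y_def using sigma_max_bound by (auto intro!: AE_I2)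
    qed measurable
    \<comment> \<open>The products of entries of \<open>d\<close> and \<open>y\<close> depend on the
      state pair alone, hence are independent of the fresh sample.\<close>
    have G_indep: "indep_var borel (\<lambda>w. G (Suc k) w $ i $ j) borel (\<lambda>w. d w $ i * y w $ j)" for i j
      using form_indep [of "Suc k" "\<lambda>s. step_matrix A s $ i $ j"
          "\<lambda>z. (fst z + \<omega> *\<^sub>R (fst z - snd z)) $ i * (A *v fst z) $ j"]
      by (simp add: G_def d_def y_def)
    have S_indep: "indep_var borel (\<lambda>w. S (Suc k) w $ i $ j) borel (\<lambda>w. y w $ i * y w $ j)" for i j
      using form_indep [of "Suc k" "\<lambda>s. second_moment_matrix A s $ i $ j"
          "\<lambda>z. (A *v fst z) $ i * (A *v fst z) $ j"]
      by (simp add: S_def y_def)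
    note G_form = indep_matrix_form [OF G_indep G(1) [OF k] d_int y_int]
    note S_form = indep_matrix_form [OF S_indep S(1) [OF k] y_int y_int]
    \<comment> \<open>\<open>?R\<close> is the expanded square, \<open>?E\<close> the same
      expression with the sample matrices replaced by their means.\<close>
    let ?R = "\<lambda>w. (norm (d w))\<^sup>2 - 2 * \<alpha> * (d w \<bullet> (G (Suc k) w *v y w))
        + \<alpha>\<^sup>2 * \<rho>\<^sup>2 * (y w \<bullet> (S (Suc k) w *v y w))"
    let ?E = "\<lambda>w. (norm (d w))\<^sup>2 - 2 * \<alpha> * ((A *v d w) \<bullet> y w) / \<phi> + \<alpha>\<^sup>2 * \<rho>\<^sup>2 * (y w \<bullet> (K *v y w))"
    have R_int: "integrable M ?R"
      using d_int G_form(1) S_form(1) by simp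
    have AE_eq: "AE w in M. (norm (e (Suc (Suc k)) w))\<^sup>2 = ?R w"
    proof -
      have "AE w in M. w \<in> space M" by simp
      then show ?thesis
        using G_AE [OF k]
      proof eventually_elim
        case (elim w)
        have "e (Suc (Suc k)) w = d w - \<alpha> *\<^sub>R (G (Suc k) w *v y w)"
          using e_Suc [of "Suc k" w] elim by (simp add: d_def y_def)
        then have "(norm (e (Suc (Suc k)) w))\<^sup>2 = (norm (d w))\<^sup>2 - 2 * \<alpha> * (d w \<bullet> (G (Suc k) w *v y w))
            + \<alpha>\<^sup>2 * (norm (G (Suc k) w *v y w))\<^sup>2"
          unfolding power2_norm_eq_inner
          by (simp add: inner_diff inner_commute [of "G (Suc k) w *v y w" "d w"] power2_eq_square
              right_diff_distrib mult.assoc)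
        also have "(norm (G (Suc k) w *v y w))\<^sup>2 = \<rho>\<^sup>2 * (y w \<bullet> (S (Suc k) w *v y w))"
          using elim by blast
        finally show ?case by (simp add: mult.assoc)
      qed
    qed
    have e_meas2 [measurable]: "e (Suc (Suc k)) \<in> borel_measurable M"
      using e_meas [of "Suc k"] by simp
    have "integrable M (\<lambda>w. (norm (e (Suc (Suc k)) w))\<^sup>2)"
      by (rule integrable_cong_AE_imp [OF R_int _ AE_symmetric [OF AE_eq]]) measurable
    moreover have "expectation (\<lambda>w. (norm (e (Suc (Suc k)) w))\<^sup>2)
        \<le> \<gamma>1 * expectation (\<lambda>w. (norm (a w))\<^sup>2) + \<gamma>2 * expectation (\<lambda>w. (norm (c w))\<^sup>2)"
    proof -
      have G_term: "d w \<bullet> (expectation (G (Suc k)) *v y w) = ((A *v d w) \<bullet> y w) / \<phi>" for w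
      proof -
        have "d w \<bullet> (expectation (G (Suc k)) *v y w) = (d w \<bullet> (transpose A *v y w)) / \<phi>"
          using G(2) [OF k]
          by (simp add: scaleR_matrix_vector_assoc [symmetric] del: transpose_matrix_vector)
        then show ?thesis by (simp only: inner_matrix_vector_mult transpose_transpose)
      qed
      have S_term: "expectation (S (Suc k)) = K"
        using S(2) [OF k] by simp
      have dy_int: "integrable M (\<lambda>w. (A *v d w) \<bullet> y w / \<phi>)" "integrable M (\<lambda>w. y w \<bullet> (K *v y w))"
        using indep_matrix_form(2) [OF G_indep G(1) [OF k] d_int y_int, of "transpose A"]
          indep_matrix_form(2) [OF S_indep S(1) [OF k] y_int y_int, of K]
        by (simp_all add: inner_matrix_vector_mult del: transpose_matrix_vector)
      have "expectation (\<lambda>w. (norm (e (Suc (Suc k)) w))\<^sup>2) = expectation ?R"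
        by (rule integral_cong_AE [OF _ borel_measurable_integrable [OF R_int] AE_eq]) measurable
      also have "\<dots> = expectation ?E"
        using d_int G_form S_form dy_int by (simp add: G_term S_term flip: times_divide_eq_right)
      also have "\<dots> \<le> expectation (\<lambda>w. \<gamma>1 * (norm (a w))\<^sup>2 + \<gamma>2 * (norm (c w))\<^sup>2)"
      proof (rule integral_mono_AE)
        show "integrable M ?E"
          using d_int dy_int by (simp flip: times_divide_eq_right)
        show "integrable M (\<lambda>w. \<gamma>1 * (norm (a w))\<^sup>2 + \<gamma>2 * (norm (c w))\<^sup>2)"
          using int by simp
        have "AE w in M. a w \<in> ?W" using e_W [of k] by simp
        then show "AE w in M. ?E w \<le> \<gamma>1 * (norm (a w))\<^sup>2 + \<gamma>2 * (norm (c w))\<^sup>2"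
        proof eventually_elim
          case (elim w)
          \<comment> \<open>\<beta>3 is the operator norm of \<open>K\<close>; this supplies the
            hypothesis on \<open>B\<close> in \<open>momentum_step_bound\<close>.\<close>
          have "\<phi> * (\<alpha>\<^sup>2 * \<rho>\<^sup>2 * (y w \<bullet> (K *v y w))) \<le> \<phi> * (\<alpha>\<^sup>2 * \<rho>\<^sup>2 * (\<beta>3 * (norm (y w))\<^sup>2))"
            using \<phi> quadratic_form_le_onorm [of "y w" K] by (intro mult_left_mono) (auto simp: \<beta>3 K_def)
          also have "\<dots> = \<alpha>\<^sup>2 * \<rho>\<^sup>2 * \<beta>3 * \<phi> * (norm (A *v a w))\<^sup>2"
            by (simp add: y_def mult_ac)
          finally show ?case
            using momentum_step_bound [OF A elim _ \<kappa> \<omega> \<phi>, of "\<alpha>\<^sup>2 * \<rho>\<^sup>2 * (y w \<bullet> (K *v y w))" "c w"] \<alpha>(1)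
            unfolding \<gamma>1 \<gamma>2 \<phi>_def [symmetric] d_def y_def by simp
        qed
      qed
      also have "\<dots> = \<gamma>1 * expectation (\<lambda>w. (norm (a w))\<^sup>2) + \<gamma>2 * expectation (\<lambda>w. (norm (c w))\<^sup>2)"
        using int by simp
      finally show ?thesis .
    qed
    ultimately show ?thesis by simp
  qed

  \<comment> \<open>Solving the recurrence\<close>
  have e_sq_init: "integrable M (\<lambda>w. (norm (e 0 w))\<^sup>2)" "integrable M (\<lambda>w. (norm (e (Suc 0) w))\<^sup>2)"
      "expectation (\<lambda>w. (norm (e 0 w))\<^sup>2) = (norm (x0 - xstar))\<^sup>2"
      "expectation (\<lambda>w. (norm (e (Suc 0) w))\<^sup>2) = (norm (x0 - xstar))\<^sup>2"
    by (simp_all add: e_0 e_1 prob_space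
        cong: Bochner_Integration.integrable_cong Bochner_Integration.integral_cong)
  have int: "integrable M (\<lambda>w. (norm (e k w))\<^sup>2) \<and> integrable M (\<lambda>w. (norm (e (Suc k) w))\<^sup>2)" for k
    by (induction k) (use e_sq_init step in auto)
  have rate: "0 \<le> \<tau>" "q * \<tau> = \<gamma>2" "\<gamma>1 + \<gamma>2 \<le> q" "q < 1"
  proof -
    have "0 \<le> \<gamma>2" unfolding \<gamma>2 using \<omega> \<alpha>(1) by simp
    then have "0 \<le> \<tau> \<and> q * \<tau> = \<gamma>2 \<and> \<gamma>1 + \<gamma>2 \<le> q \<and> q < 1"
    proof (cases "\<omega> > 0")
      case True
      with q have "q = (\<gamma>1 + sqrt (\<gamma>1\<^sup>2 + 4 * \<gamma>2)) / 2" by simp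
      from characteristic_root [OF \<open>0 \<le> \<gamma>2\<close> \<gamma>_sum this] show ?thesis by (simp add: \<tau>)
    next
      \<comment> \<open>Without momentum \<gamma>2 and \<tau> vanish. The root formula would give
        max(\<gamma>1, 0), so \<open>q = \<gamma>1\<close> is treated separately.\<close>
      case False
      with \<omega> have "\<omega> = 0" by simp
      then have "\<gamma>2 = 0" "q = \<gamma>1" using q by (simp_all add: \<gamma>2)
      then show ?thesis using \<gamma>_sum by (simp add: \<tau>)
    qed
    then show "0 \<le> \<tau>" "q * \<tau> = \<gamma>2" "\<gamma>1 + \<gamma>2 \<le> q" "q < 1" by simp_all
  qed
  have "expectation (\<lambda>w. (norm (e (Suc k) w))\<^sup>2)
      \<le> q ^ k * (1 + \<tau>) * expectation (\<lambda>w. (norm (e 0 w))\<^sup>2)" for k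
    using step int e_sq_init(3,4) rate(1,2) \<tau>
    by (intro two_term_recurrence_bound [of "\<lambda>k. expectation (\<lambda>w. (norm (e k w))\<^sup>2)" \<gamma>1 \<gamma>2])
      (auto intro: Bochner_Integration.integral_nonneg)
  then show ?thesis
    using int rate(1,3,4) e_sq_init(3) by (simp add: e_def)
qed

end
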